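(* For every integer $n\ge5$, $\Lambda_{n,bd}=\mathbb C$.
   Context: $\Lambda_{n,bd}$ is the set of all $\lambda\in\mathbb C$ for which there exist a nonzero complex separable Hilbert space $H$ and bounded operators $Q_1,\dots,Q_n\in B(H)$ with $Q_k^2=Q_k$ ($k=1,\dots,n$) and $\sum_{k=1}^nQ_k=\lambda I$ (the idempotents need not be selfadjoint). *)

theory Defs
  imports "HOL-Analysis.Analysis" "HOL-Algebra.Module"
begin

text \<open>
  The statement quantifies existentially over Hilbert spaces, so Hilbert spaces are represented
  as structures with an explicit carrier, extending the modules of \<open>HOL-Algebra\<close>.  The fields
  \<open>mult\<close> and \<open>one\<close>, which every \<open>HOL-Algebra\<close> module record inherits from rings, are unused.
\<close>

definition complex_field :: "complex ring" where
  "complex_field = \<lparr>carrier = UNIV, mult = (*), one = 1, zero = 0, add = (+)\<rparr>"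

record 'a cip_space = "(complex, 'a) module" +
  cip :: "'a \<Rightarrow> 'a \<Rightarrow> complex"

locale complex_inner_product_space = Module.module complex_field H
  for H :: "'a cip_space" (structure) +
  assumes cip_add_left: "\<lbrakk>x \<in> carrier H; y \<in> carrier H; z \<in> carrier H\<rbrakk>
      \<Longrightarrow> cip H (x \<oplus> y) z = cip H x z + cip H y z"
    and cip_smult_left: "\<lbrakk>x \<in> carrier H; y \<in> carrier H\<rbrakk>
      \<Longrightarrow> cip H (a \<odot> x) y = a * cip H x y"
    and cip_cnj: "\<lbrakk>x \<in> carrier H; y \<in> carrier H\<rbrakk> \<Longrightarrow> cip H y x = cnj (cip H x y)"
    and cip_pos: "\<lbrakk>x \<in> carrier H; x \<noteq> \<zero>\<rbrakk> \<Longrightarrow> 0 < Re (cip H x x)"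

definition ip_norm :: "'a cip_space \<Rightarrow> 'a \<Rightarrow> real" where
  "ip_norm H x = sqrt (Re (cip H x x))"

text \<open>The locale \<open>Metric_space\<close> requires nonnegativity and symmetry of the distance
  also outside the carrier, hence the default value \<open>0\<close> there.\<close>

definition ip_dist :: "'a cip_space \<Rightarrow> 'a \<Rightarrow> 'a \<Rightarrow> real" where
  "ip_dist H x y =
     (if x \<in> carrier H \<and> y \<in> carrier H then ip_norm H (x \<ominus>\<^bsub>H\<^esub> y) else 0)"

locale complex_hilbert_space = complex_inner_product_space +
  assumes complete: "Metric_space.mcomplete (carrier H) (ip_dist H)"

definition separable_ip_space :: "'a cip_space \<Rightarrow> bool" where
  "separable_ip_space H \<longleftrightarrow>
     separable_space (Metric_space.mtopology (carrier H) (ip_dist H))"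

text \<open>Operators are functions on the whole type; only their values on the carrier matter.\<close>

definition bounded_operator :: "'a cip_space \<Rightarrow> ('a \<Rightarrow> 'a) \<Rightarrow> bool" where
  "bounded_operator H T \<longleftrightarrow>
     T \<in> carrier H \<rightarrow> carrier H \<and>
     (\<forall>x\<in>carrier H. \<forall>y\<in>carrier H. T (x \<oplus>\<^bsub>H\<^esub> y) = T x \<oplus>\<^bsub>H\<^esub> T y) \<and>
     (\<forall>a. \<forall>x\<in>carrier H. T (a \<odot>\<^bsub>H\<^esub> x) = a \<odot>\<^bsub>H\<^esub> T x) \<and>
     (\<exists>B. \<forall>x\<in>carrier H. ip_norm H (T x) \<le> B * ip_norm H x)"

definition scalar_sum_of_idempotents ::
  "'a cip_space \<Rightarrow> nat \<Rightarrow> (nat \<Rightarrow> 'a \<Rightarrow> 'a) \<Rightarrow> complex \<Rightarrow> bool" where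
  "scalar_sum_of_idempotents H n Q c \<longleftrightarrow>
     (\<forall>k\<in>{1..n}. bounded_operator H (Q k) \<and> (\<forall>x\<in>carrier H. Q k (Q k x) = Q k x)) \<and>
     (\<forall>x\<in>carrier H. finsum H (\<lambda>k. Q k x) {1..n} = c \<odot>\<^bsub>H\<^esub> x)"

text \<open>
  HOL cannot quantify over types inside a formula, so the carrier of \<open>H\<close> is taken to be an
  arbitrary subset of the type \<open>nat \<Rightarrow> complex\<close>, with arbitrary operations and inner product on it.
  This is no restriction, as every separable Hilbert space has at most the cardinality of the
  continuum; see the lemma \<open>Lambda_bd_I\<close> below, in which the underlying type is arbitrary.
\<close>

definition Lambda_bd :: "nat \<Rightarrow> complex set" where
  "Lambda_bd n =
     {c. \<exists>(H :: (nat \<Rightarrow> complex) cip_space) Q.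
        complex_hilbert_space H \<and> separable_ip_space H \<and> carrier H \<noteq> {\<zero>\<^bsub>H\<^esub>} \<and>
        scalar_sum_of_idempotents H n Q c}"


lemma complex_field_simps [simp]:
  "carrier complex_field = UNIV" "mult complex_field = (*)" "one complex_field = 1"
  "zero complex_field = 0" "add complex_field = (+)"
  by (simp_all add: complex_field_def)

lemma cring_complex_field: "cring complex_field"
proof (rule cringI)
  show "abelian_group complex_field"
    by (rule abelian_groupI) (auto simp: algebra_simps intro: exI [of _ "- x" for x])
  show "comm_monoid complex_field"
    by (rule comm_monoidI) (auto simp: algebra_simps)
qed (auto simp: algebra_simps)

context complex_inner_product_space
begin

lemma cip_zero_left: "y \<in> carrier H \<Longrightarrow> cip H \<zero> y = 0"
  using cip_add_left[of \<zero> \<zero> y] by simp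

lemma cip_minus_left:
  assumes "x \<in> carrier H" "y \<in> carrier H" shows "cip H (\<ominus> x) y = - cip H x y"
proof -
  have "cip H (x \<oplus> \<ominus> x) y = cip H x y + cip H (\<ominus> x) y"
    using assms by (intro cip_add_left) auto
  then show ?thesis
    using assms by (simp add: M.r_neg cip_zero_left add_eq_0_iff)
qed

lemma cip_diff_left:
  "\<lbrakk>x \<in> carrier H; y \<in> carrier H; z \<in> carrier H\<rbrakk> \<Longrightarrow> cip H (x \<ominus> y) z = cip H x z - cip H y z"
  by (simp add: a_minus_def cip_add_left cip_minus_left)

lemma cip_add_right:
  "\<lbrakk>x \<in> carrier H; y \<in> carrier H; z \<in> carrier H\<rbrakk> \<Longrightarrow> cip H z (x \<oplus> y) = cip H z x + cip H z y"
  using cip_cnj[of "x \<oplus> y" z] cip_cnj[of x z] cip_cnj[of y z] cip_add_left by simp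

lemma cip_diff_right:
  "\<lbrakk>x \<in> carrier H; y \<in> carrier H; z \<in> carrier H\<rbrakk> \<Longrightarrow> cip H z (x \<ominus> y) = cip H z x - cip H z y"
  using cip_cnj[of "x \<ominus> y" z] cip_cnj[of x z] cip_cnj[of y z] cip_diff_left by simp

lemma cip_smult_right:
  "\<lbrakk>x \<in> carrier H; y \<in> carrier H\<rbrakk> \<Longrightarrow> cip H x (a \<odot> y) = cnj a * cip H x y"
  using cip_cnj[of "a \<odot> y" x] cip_cnj[of y x] cip_smult_left by simp

lemma Im_cip_self: "x \<in> carrier H \<Longrightarrow> Im (cip H x x) = 0"
  by (metis cip_cnj complex_cnj_cancel_iff Reals_cnj_iff complex_is_Real_iff)

lemma Re_cip_self_nonneg: "x \<in> carrier H \<Longrightarrow> 0 \<le> Re (cip H x x)"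
  using cip_pos[of x] cip_zero_left[of \<zero>] by (cases "x = \<zero>") auto

lemma cip_self: "x \<in> carrier H \<Longrightarrow> cip H x x = complex_of_real ((ip_norm H x)\<^sup>2)"
  by (simp add: ip_norm_def Re_cip_self_nonneg Im_cip_self complex_eq_iff)

lemma ip_norm_nonneg: "x \<in> carrier H \<Longrightarrow> 0 \<le> ip_norm H x"
  by (simp add: ip_norm_def Re_cip_self_nonneg)

lemma ip_norm_eq_0_iff: "x \<in> carrier H \<Longrightarrow> ip_norm H x = 0 \<longleftrightarrow> x = \<zero>"
  using cip_pos[of x] cip_zero_left[of \<zero>] by (cases "x = \<zero>") (auto simp: ip_norm_def)

lemma Cauchy_Schwarz:
  assumes x: "x \<in> carrier H" and y: "y \<in> carrier H"
  shows "cmod (cip H x y) \<le> ip_norm H x * ip_norm H y"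
proof (cases "y = \<zero>")
  case True
  then have "cip H x y = 0"
    using cip_cnj[of y x] cip_zero_left[of x] x y by simp
  then show ?thesis
    using ip_norm_nonneg x y by simp
next
  case False
  define c N where "c = cip H x y" and "N = (ip_norm H y)\<^sup>2"
  define a where "a = c / complex_of_real N"
  have N: "N > 0"
    using False ip_norm_eq_0_iff[OF y] by (simp add: N_def)
  have yy: "cip H y y = complex_of_real N" and yx: "cip H y x = cnj c"
    using cip_self[OF y] cip_cnj[OF x y] by (simp_all add: N_def c_def)
  have ay: "a \<odot> y \<in> carrier H"
    using y by simp
  have "cip H (x \<ominus> a \<odot> y) (x \<ominus> a \<odot> y)
      = cip H x x - cnj a * c - a * (cnj c) + a * cnj a * complex_of_real N"
    using x y ay
    by (simp add: cip_diff_left cip_diff_right cip_smult_left cip_smult_right yy yx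
        c_def[symmetric] algebra_simps)
  also have "\<dots> = cip H x x - c * cnj c / complex_of_real N"
    using N by (simp add: a_def field_simps)
  also have "\<dots> = complex_of_real ((ip_norm H x)\<^sup>2 - (cmod c)\<^sup>2 / N)"
    by (simp add: cip_self[OF x] complex_norm_square[symmetric])
  finally have "0 \<le> (ip_norm H x)\<^sup>2 - (cmod c)\<^sup>2 / N"
    using Re_cip_self_nonneg[of "x \<ominus> a \<odot> y"] x ay by simp
  then have "(cmod c)\<^sup>2 \<le> (ip_norm H x * ip_norm H y)\<^sup>2"
    using N by (simp add: field_simps N_def)
  then show ?thesis
    unfolding c_def using ip_norm_nonneg x y by (simp add: power2_le_iff_abs_le)
qed

lemma ip_norm_triangle:
  assumes x: "x \<in> carrier H" and y: "y \<in> carrier H"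
  shows "ip_norm H (x \<oplus> y) \<le> ip_norm H x + ip_norm H y"
proof -
  have "(ip_norm H (x \<oplus> y))\<^sup>2 = Re (cip H (x \<oplus> y) (x \<oplus> y))"
    using x y by (simp add: cip_self)
  also have "\<dots> = (ip_norm H x)\<^sup>2 + (ip_norm H y)\<^sup>2 + 2 * Re (cip H x y)"
    using x y cip_cnj[OF x y]
    by (simp add: cip_add_left cip_add_right cip_self[OF x] cip_self[OF y])
  also have "\<dots> \<le> (ip_norm H x)\<^sup>2 + (ip_norm H y)\<^sup>2 + 2 * (ip_norm H x * ip_norm H y)"
    using Cauchy_Schwarz[OF x y] complex_Re_le_cmod[of "cip H x y"] by linarith
  also have "\<dots> = (ip_norm H x + ip_norm H y)\<^sup>2"
    by (simp add: power2_sum)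
  finally show ?thesis
    by (rule power2_le_imp_le) (simp add: ip_norm_nonneg x y)
qed

lemma ip_norm_minus: "x \<in> carrier H \<Longrightarrow> ip_norm H (\<ominus> x) = ip_norm H x"
  using cip_cnj[of "\<ominus> x" x] by (simp add: ip_norm_def cip_minus_left)

lemma minus_eq_zero_iff:
  "\<lbrakk>x \<in> carrier H; y \<in> carrier H\<rbrakk> \<Longrightarrow> x \<ominus> y = \<zero> \<longleftrightarrow> x = y"
proof -
  assume xy: "x \<in> carrier H" "y \<in> carrier H"
  have *: "(x \<ominus> y) \<oplus> y = x"
    using xy by (simp add: a_minus_def M.a_assoc M.l_neg)
  show ?thesis
  proof
    assume "x \<ominus> y = \<zero>"
    then show "x = y"
      using * xy by simp
  next
    assume "x = y"
    then show "x \<ominus> y = \<zero>"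
      using xy by (simp add: a_minus_def M.r_neg)
  qed
qed

lemma Metric_space_ip_dist: "Metric_space (carrier H) (ip_dist H)"
proof
  fix x y
  show "0 \<le> ip_dist H x y"
    by (simp add: ip_dist_def ip_norm_nonneg)
  have "ip_norm H (x \<ominus> y) = ip_norm H (y \<ominus> x)" if "x \<in> carrier H" "y \<in> carrier H"
    using ip_norm_minus[of "x \<ominus> y"] that
    by (simp add: a_minus_def M.minus_add M.minus_minus M.a_comm)
  then show "ip_dist H x y = ip_dist H y x"
    by (simp add: ip_dist_def)
next
  fix x y assume "x \<in> carrier H" "y \<in> carrier H"
  then show "ip_dist H x y = 0 \<longleftrightarrow> x = y"
    by (simp add: ip_dist_def ip_norm_eq_0_iff minus_eq_zero_iff)
next
  fix x y z assume *: "x \<in> carrier H" "y \<in> carrier H" "z \<in> carrier H"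
  then have "x \<ominus> z = (x \<ominus> y) \<oplus> (y \<ominus> z)"
    by (simp add: a_minus_def M.a_ac M.r_neg1 M.r_neg2)
  then show "ip_dist H x z \<le> ip_dist H x y + ip_dist H y z"
    using * ip_norm_triangle[of "x \<ominus> y" "y \<ominus> z"] by (simp add: ip_dist_def)
qed

end

sublocale complex_inner_product_space \<subseteq> ip: Metric_space "carrier H" "ip_dist H"
  by (rule Metric_space_ip_dist)

lemma (in complex_inner_product_space) separable_iff:
  "separable_ip_space H \<longleftrightarrow>
     (\<exists>C. countable C \<and> C \<subseteq> carrier H \<and>
       (\<forall>x\<in>carrier H. \<forall>r>0. \<exists>y\<in>C. ip_dist H x y < r))"
proof -
  have eq: "ip.mtopology closure_of C = carrier H \<longleftrightarrow>
      (\<forall>x\<in>carrier H. \<forall>r>0. \<exists>y\<in>C. ip_dist H x y < r)" if "C \<subseteq> carrier H" for C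
  proof -
    have cl: "ip.mtopology closure_of C \<subseteq> carrier H"
      using closure_of_subset_topspace[of ip.mtopology C] unfolding ip.topspace_mtopology .
    have mem: "x \<in> ip.mtopology closure_of C \<longleftrightarrow> (\<forall>r>0. \<exists>y\<in>C. ip_dist H x y < r)"
      if x: "x \<in> carrier H" for x
    proof -
      have "y \<in> ip.mball x r \<longleftrightarrow> ip_dist H x y < r" if "y \<in> C" for y r
        using that x \<open>C \<subseteq> carrier H\<close> unfolding ip.in_mball by blast
      then show ?thesis
        using x by (simp add: ip.metric_closure_of cong: bex_cong)
    qed
    have "ip.mtopology closure_of C = carrier H \<longleftrightarrow>
        (\<forall>x\<in>carrier H. x \<in> ip.mtopology closure_of C)"
    proof
      assume "\<forall>x\<in>carrier H. x \<in> ip.mtopology closure_of C"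
      then show "ip.mtopology closure_of C = carrier H"
        by (intro subset_antisym cl subsetI) (rule bspec)
    qed simp
    also have "\<dots> \<longleftrightarrow> (\<forall>x\<in>carrier H. \<forall>r>0. \<exists>y\<in>C. ip_dist H x y < r)"
      by (simp only: mem cong: ball_cong)
    finally show ?thesis .
  qed
  show ?thesis
    unfolding separable_ip_space_def separable_space_def ip.topspace_mtopology
    by (simp only: eq cong: conj_cong)
qed


text \<open>Transport of a Hilbert space structure along an injection of its carrier.\<close>

definition transport_cip :: "('a \<Rightarrow> 'b) \<Rightarrow> 'a cip_space \<Rightarrow> 'b cip_space" where
  "transport_cip f H = (let g = inv_into (carrier H) f in
     \<lparr>carrier = f ` carrier H, mult = undefined, one = undefined, zero = f \<zero>\<^bsub>H\<^esub>,
      add = (\<lambda>x y. f (g x \<oplus>\<^bsub>H\<^esub> g y)), smult = (\<lambda>a x. f (a \<odot>\<^bsub>H\<^esub> g x)),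
      cip = (\<lambda>x y. cip H (g x) (g y))\<rparr>)"

locale cip_transport = complex_inner_product_space +
  fixes f :: "'a \<Rightarrow> 'b"
  assumes inj: "inj_on f (carrier H)"
begin

definition K where "K = transport_cip f H"

lemma K_simps [simp]:
  "carrier K = f ` carrier H" "\<zero>\<^bsub>K\<^esub> = f \<zero>"
  by (simp_all add: K_def transport_cip_def Let_def)

lemma K_ops [simp]:
  "\<lbrakk>x \<in> carrier H; y \<in> carrier H\<rbrakk> \<Longrightarrow> f x \<oplus>\<^bsub>K\<^esub> f y = f (x \<oplus> y)"
  "x \<in> carrier H \<Longrightarrow> a \<odot>\<^bsub>K\<^esub> f x = f (a \<odot> x)"
  "\<lbrakk>x \<in> carrier H; y \<in> carrier H\<rbrakk> \<Longrightarrow> cip K (f x) (f y) = cip H x y"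
  by (simp_all add: K_def transport_cip_def Let_def inv_into_f_f[OF inj])

lemma f_eq_iff [simp]: "\<lbrakk>x \<in> carrier H; y \<in> carrier H\<rbrakk> \<Longrightarrow> f x = f y \<longleftrightarrow> x = y"
  using inj by (auto dest: inj_onD)

lemma abelian_group_K: "abelian_group K"
proof (rule abelian_groupI)
  fix x assume "x \<in> carrier K"
  then obtain u where u: "u \<in> carrier H" "x = f u" by auto
  then show "\<exists>y\<in>carrier K. y \<oplus>\<^bsub>K\<^esub> x = \<zero>\<^bsub>K\<^esub>"
    by (auto intro!: bexI[of _ "\<ominus> u"] simp: M.l_neg)
qed (auto simp: M.a_ac)

lemma ip_space_K: "complex_inner_product_space K"
proof -
  have m: "Module.module complex_field K"
    by (rule moduleI[OF cring_complex_field abelian_group_K])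
      (use smult_l_distr smult_assoc1 smult_r_distr smult_one in auto)
  show ?thesis
    by (intro complex_inner_product_space.intro[OF m] complex_inner_product_space_axioms.intro)
      (auto simp: cip_add_left cip_smult_left cip_pos intro: cip_cnj)
qed

sublocale K: complex_inner_product_space K
  by (rule ip_space_K)

lemma K_minus: assumes "x \<in> carrier H" shows "\<ominus>\<^bsub>K\<^esub> f x = f (\<ominus> x)"
  using assms by (intro K.M.minus_equality) (auto simp: M.l_neg)

lemma ip_norm_K [simp]: "x \<in> carrier H \<Longrightarrow> ip_norm K (f x) = ip_norm H x"
  by (simp add: ip_norm_def)

lemma ip_dist_K [simp]:
  "\<lbrakk>x \<in> carrier H; y \<in> carrier H\<rbrakk> \<Longrightarrow> ip_dist K (f x) (f y) = ip_dist H x y"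
  by (simp add: ip_dist_def a_minus_def K_minus)

lemma finsum_K:
  "\<lbrakk>finite A; \<And>k. k \<in> A \<Longrightarrow> u k \<in> carrier H\<rbrakk>
    \<Longrightarrow> finsum K (\<lambda>k. f (u k)) A = f (finsum H u A)"
proof (induction A rule: finite_induct)
  case (insert a A)
  then show ?case
    by (subst K.M.finsum_insert) (auto simp: M.finsum_insert Pi_def)
qed simp

lemma complete_K:
  assumes "ip.mcomplete" shows "K.ip.mcomplete"
  unfolding K.ip.mcomplete_def
proof (intro allI impI)
  fix s assume s: "K.ip.MCauchy s"
  define t where "t = (\<lambda>n. inv_into (carrier H) f (s n))"
  have "s n \<in> f ` carrier H" for n
    using s unfolding K.ip.MCauchy_def unfolding K_simps(1) by blast
  then have t: "t n \<in> carrier H" "s n = f (t n)" for n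
    unfolding t_def by (rule inv_into_into, simp only: f_inv_into_f)
  have dist: "ip_dist K (s m) (s n) = ip_dist H (t m) (t n)" for m n
    by (simp only: t(2) ip_dist_K[OF t(1) t(1)])
  have "ip.MCauchy t"
    using s t(1) unfolding K.ip.MCauchy_def ip.MCauchy_def dist by blast
  then obtain x where lim: "limitin ip.mtopology t x sequentially"
    using assms unfolding ip.mcomplete_def by blast
  then have x: "x \<in> carrier H"
    unfolding ip.limitin_metric by blast
  have dist_x: "ip_dist K (s n) (f x) = ip_dist H (t n) x" for n
    by (simp only: t(2) ip_dist_K[OF t(1) x])
  have "limitin K.ip.mtopology s (f x) sequentially"
    unfolding K.ip.limitin_metric dist_x
    using lim x t unfolding ip.limitin_metric by simp
  then show "\<exists>x. limitin K.ip.mtopology s x sequentially" ..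
qed

lemma separable_K:
  assumes "separable_ip_space H" shows "separable_ip_space K"
proof -
  obtain C where C: "countable C" "C \<subseteq> carrier H"
      "\<And>x r. \<lbrakk>x \<in> carrier H; r > 0\<rbrakk> \<Longrightarrow> \<exists>y\<in>C. ip_dist H x y < r"
    using assms unfolding separable_iff by blast
  have "\<exists>y\<in>f ` C. ip_dist K (f x) y < r" if x: "x \<in> carrier H" and r: "r > 0" for x r
  proof -
    obtain y where "y \<in> C" "ip_dist H x y < r"
      using C(3)[OF x r] by blast
    then show ?thesis
      using C(2) x by (intro bexI[of _ "f y"]) (auto simp: subset_iff)
  qed
  then have "\<forall>x\<in>carrier K. \<forall>r>0. \<exists>y\<in>f ` C. ip_dist K x y < r"
    by auto
  moreover have "countable (f ` C)" "f ` C \<subseteq> carrier K"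
    using C by auto
  ultimately show ?thesis
    unfolding K.separable_iff by blast
qed

lemma scalar_sum_K:
  assumes Q: "scalar_sum_of_idempotents H n Q c"
  defines "R \<equiv> \<lambda>k x. f (Q k (inv_into (carrier H) f x))"
  shows "scalar_sum_of_idempotents K n R c"
proof -
  have R: "R k (f x) = f (Q k x)" if "x \<in> carrier H" for k x
    using that by (simp add: R_def inv_into_f_f[OF inj])
  have Qc: "Q k x \<in> carrier H" if "k \<in> {1..n}" "x \<in> carrier H" for k x
    using Q that unfolding scalar_sum_of_idempotents_def bounded_operator_def by blast
  have "bounded_operator K (R k) \<and> (\<forall>x\<in>carrier K. R k (R k x) = R k x)" if k: "k \<in> {1..n}" for k
  proof -
    obtain B where add: "\<And>x y. \<lbrakk>x \<in> carrier H; y \<in> carrier H\<rbrakk> \<Longrightarrow> Q k (x \<oplus> y) = Q k x \<oplus> Q k y"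
      and smult: "\<And>a x. x \<in> carrier H \<Longrightarrow> Q k (a \<odot> x) = a \<odot> Q k x"
      and B: "\<And>x. x \<in> carrier H \<Longrightarrow> ip_norm H (Q k x) \<le> B * ip_norm H x"
      and idem: "\<And>x. x \<in> carrier H \<Longrightarrow> Q k (Q k x) = Q k x"
      using Q k unfolding scalar_sum_of_idempotents_def bounded_operator_def by blast
    have "\<exists>B. \<forall>x\<in>carrier K. ip_norm K (R k x) \<le> B * ip_norm K x"
      using B Qc[OF k] by (intro exI[of _ B]) (simp add: R)
    moreover have "R k \<in> carrier K \<rightarrow> carrier K"
      using Qc[OF k] by (auto simp: R)
    ultimately show ?thesis
      unfolding bounded_operator_def using Qc[OF k] by (simp add: R add smult idem)
  qed
  moreover have "finsum K (\<lambda>k. R k x) {1..n} = c \<odot>\<^bsub>K\<^esub> x" if x: "x \<in> carrier K" for x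
  proof -
    obtain u where u: "u \<in> carrier H" "x = f u" using x by auto
    have "finsum K (\<lambda>k. R k x) {1..n} = finsum K (\<lambda>k. f (Q k u)) {1..n}"
      by (simp only: u(2) R[OF u(1)])
    also have "\<dots> = f (finsum H (\<lambda>k. Q k u) {1..n})"
      by (rule finsum_K) (use Qc u(1) in auto)
    also have "finsum H (\<lambda>k. Q k u) {1..n} = c \<odot> u"
      using Q u(1) unfolding scalar_sum_of_idempotents_def by blast
    also have "f (c \<odot> u) = c \<odot>\<^bsub>K\<^esub> x"
      using u by simp
    finally show ?thesis .
  qed
  ultimately show ?thesis
    unfolding scalar_sum_of_idempotents_def by blast
qed

end

lemma (in complex_inner_product_space) separable_imp_injection:
  assumes "separable_ip_space H"
  shows "\<exists>f :: 'a \<Rightarrow> nat \<Rightarrow> complex. inj_on f (carrier H)"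
proof -
  obtain C where C: "countable C" "C \<subseteq> carrier H"
      "\<And>x r. \<lbrakk>x \<in> carrier H; r > 0\<rbrakk> \<Longrightarrow> \<exists>y\<in>C. ip_dist H x y < r"
    using assms unfolding separable_iff by blast
  define f where "f = (\<lambda>x k. cip H x (from_nat_into C k))"
  have "x = y" if x: "x \<in> carrier H" and y: "y \<in> carrier H" and eq: "f x = f y" for x y
  proof (rule ccontr)
    assume "x \<noteq> y"
    define z where "z = x \<ominus> y"
    have z: "z \<in> carrier H"
      using x y by (simp add: z_def)
    have "z \<noteq> \<zero>"
      using \<open>x \<noteq> y\<close> x y by (simp add: z_def minus_eq_zero_iff)
    then have "ip_norm H z > 0"
      using ip_norm_eq_0_iff[OF z] ip_norm_nonneg[OF z] by simp
    then obtain w where w: "w \<in> C" "ip_dist H z w < ip_norm H z"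
      using C(3)[OF z] by blast
    then have wH: "w \<in> carrier H"
      using C by blast
    obtain k where "w = from_nat_into C k"
      using w(1) C(1) by (metis from_nat_into_surj)
    then have zw: "cip H z w = 0"
      using fun_cong[OF eq, of k] x y wH by (simp add: f_def z_def cip_diff_left)
    then have "cip H w z = 0"
      using cip_cnj[OF z wH] by simp
    then have "Re (cip H (z \<ominus> w) (z \<ominus> w)) = Re (cip H z z) + Re (cip H w w)"
      using z wH zw by (simp add: cip_diff_left cip_diff_right)
    then have "ip_norm H z \<le> ip_dist H z w"
      using z wH Re_cip_self_nonneg[OF wH] by (simp add: ip_dist_def ip_norm_def)
    then show False
      using w by simp
  qed
  then show ?thesis
    by (blast intro: inj_onI)
qed

lemma Lambda_bd_I:
  fixes H :: "'a cip_space"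
  assumes "complex_hilbert_space H" "separable_ip_space H" "carrier H \<noteq> {\<zero>\<^bsub>H\<^esub>}"
    and "scalar_sum_of_idempotents H n Q c"
  shows "c \<in> Lambda_bd n"
proof -
  have 1: "complex_inner_product_space H"
    by (rule complex_hilbert_space.axioms(1)[OF assms(1)])
  have "\<exists>f :: 'a \<Rightarrow> nat \<Rightarrow> complex. inj_on f (carrier H)"
    by (rule complex_inner_product_space.separable_imp_injection[OF 1 assms(2)])
  then obtain f :: "'a \<Rightarrow> nat \<Rightarrow> complex" where f: "inj_on f (carrier H)" ..
  interpret cip_transport H f
    by (rule cip_transport.intro[OF 1 cip_transport_axioms.intro[OF f]])
  have hilbert: "complex_hilbert_space K"
    by (rule complex_hilbert_space.intro[OF ip_space_K complex_hilbert_space_axioms.intro])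
      (rule complete_K[OF complex_hilbert_space.complete[OF assms(1)]])
  obtain x where "x \<in> carrier H" "x \<noteq> \<zero>\<^bsub>H\<^esub>"
    using assms(3) M.zero_closed by blast
  then have "f x \<in> carrier K" "f x \<noteq> \<zero>\<^bsub>K\<^esub>"
    by simp_all
  then have nonzero: "carrier K \<noteq> {\<zero>\<^bsub>K\<^esub>}"
    by blast
  show ?thesis
    unfolding Lambda_bd_def mem_Collect_eq
    by (rule exI[of _ K], rule exI, intro conjI, rule hilbert, rule separable_K[OF assms(2)],
        rule nonzero, rule scalar_sum_K[OF assms(4)])
qed
end

theory Submission
  imports Defs
begin

text \<open>
  Zero operators can be added to a sum of idempotents, so five idempotents are enough.  They act on
  \<open>K \<oplus> K\<close>, where \<open>K\<close> is the space of square-summable sequences.  Two constructions give pairs of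
  idempotents with diagonal sum, both instances of the fact that \<open>(1 + Z \<plusminus> W) / 2\<close> are idempotent
  with sum \<open>1 + Z\<close> if \<open>Z W = - W Z\<close> and \<open>Z\<^sup>2 + W\<^sup>2 = 1\<close>:

  \<^item> For any operator \<open>A\<close> on \<open>K\<close>, the two operators \<open>tilt (\<plusminus>1) A\<close> have sum \<open>2 A \<oplus> 2 (1 - A)\<close>.

  \<^item> For operators \<open>V, W\<close> on \<open>K\<close> there is a pair with sum \<open>(2 + W V) \<oplus> (- V W)\<close>.  The operators
    \<open>shear (\<plusminus>1) k\<close> are the case \<open>W = S*\<close> and \<open>V = k S\<close> for an isometry \<open>S\<close>, with sum
    \<open>(2 + k) \<oplus> (- k S S*)\<close>.

  The two diagonal blocks of such a sum of four idempotents thus add up to 2 plus 2 plus the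
  commutator of \<open>W\<close> and \<open>V\<close>.  In finite dimension all traces of sums of idempotents are integers.
  In infinite dimension a commutator has no trace to respect: for the isometry \<open>S\<close> the commutator of
  \<open>S*\<close> and \<open>k S\<close> is \<open>k (1 - S S*)\<close>, a multiple of a projection with infinite-dimensional range.
  This is what lets the fifth idempotent reach an arbitrary scalar.

  Take for \<open>S\<close> and \<open>R\<close> the isometries of \<open>K\<close> onto the sequences supported on the even and on the
  odd indices, so \<open>S S* + R R* = 1\<close>.  Put \<open>m = c - 2\<close>.  Splitting \<open>K\<close> itself as \<open>K \<oplus> K\<close> by means of
  \<open>S\<close> and \<open>R\<close>, the first construction with the scalar operator \<open>m\<close> for \<open>A\<close> gives idempotents
  \<open>E\<close> and \<open>F\<close> on \<open>K\<close> with \<open>E + F = 2 m S S* + (2 - 2 m) R R*\<close>, and \<open>E \<oplus> F\<close> is the fifth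
  idempotent.  With the parameters \<open>A\<close> and \<open>k\<close> still free, the five idempotents have the sum
  \<open>(E + 2 A + 2 + k) \<oplus> (F + 2 - 2 A - k S S*)\<close>.
  Requiring the first block to be \<open>2 + m\<close> determines \<open>2 A = m - k - E\<close>, and then the second block
  is \<open>E + F + 2 - m + k (1 - S S*) = E + F + 2 - m + k R R*\<close>.  This is the scalar \<open>2 + m\<close> on the
  range of \<open>S\<close> for every \<open>k\<close>, and on the range of \<open>R\<close> exactly for \<open>k = 4 m - 2\<close>.

  Since \<open>K\<close> is isomorphic to \<open>K \<oplus> K\<close> by means of \<open>S\<close> and \<open>R\<close>, the five idempotents are realised on
  \<open>K\<close>: the even and odd parts of a sequence are its two components in \<open>K \<oplus> K\<close>.
\<close>

section \<open>The Hilbert space of square-summable sequences\<close>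

definition l2_set :: "(nat \<Rightarrow> complex) set" where
  "l2_set = {x. summable (\<lambda>i. (cmod (x i))\<^sup>2)}"

definition l2 :: "(nat \<Rightarrow> complex) cip_space" where
  "l2 = \<lparr>carrier = l2_set, mult = undefined, one = undefined, zero = (\<lambda>i. 0),
         add = (\<lambda>x y i. x i + y i), smult = (\<lambda>a x i. a * x i),
         cip = (\<lambda>x y. \<Sum>i. x i * cnj (y i))\<rparr>"

lemma l2_simps [simp]:
  "carrier l2 = l2_set" "\<zero>\<^bsub>l2\<^esub> = (\<lambda>i. 0)" "x \<oplus>\<^bsub>l2\<^esub> y = (\<lambda>i. x i + y i)"
  "a \<odot>\<^bsub>l2\<^esub> x = (\<lambda>i. a * x i)" "cip l2 x y = (\<Sum>i. x i * cnj (y i))"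
  by (simp_all add: l2_def)

lemma l2_set_zero [simp]: "(\<lambda>i. 0) \<in> l2_set"
  by (simp add: l2_set_def)

lemma l2_set_scale [simp]: "x \<in> l2_set \<Longrightarrow> (\<lambda>i. a * x i) \<in> l2_set"
  by (simp add: l2_set_def norm_mult power_mult_distrib)

lemma l2_set_add [simp]:
  assumes "x \<in> l2_set" "y \<in> l2_set" shows "(\<lambda>i. x i + y i) \<in> l2_set"
proof -
  have "(cmod (x i + y i))\<^sup>2 \<le> 2 * (cmod (x i))\<^sup>2 + 2 * (cmod (y i))\<^sup>2" for i
  proof -
    have "(cmod (x i + y i))\<^sup>2 \<le> (cmod (x i) + cmod (y i))\<^sup>2"
      by (simp add: norm_triangle_ineq power_mono)
    also have "\<dots> \<le> 2 * (cmod (x i))\<^sup>2 + 2 * (cmod (y i))\<^sup>2"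
      using sum_squares_bound[of "cmod (x i)" "cmod (y i)"] by (simp add: power2_sum)
    finally show ?thesis .
  qed
  moreover have "summable (\<lambda>i. 2 * (cmod (x i))\<^sup>2 + 2 * (cmod (y i))\<^sup>2)"
    using assms by (intro summable_add summable_mult) (auto simp: l2_set_def)
  ultimately show ?thesis
    unfolding l2_set_def by (auto intro: summable_comparison_test')
qed

lemma l2_set_minus [simp]: "x \<in> l2_set \<Longrightarrow> (\<lambda>i. - x i) \<in> l2_set"
  by (simp add: l2_set_def)

lemma l2_set_diff [simp]: "x \<in> l2_set \<Longrightarrow> y \<in> l2_set \<Longrightarrow> (\<lambda>i. x i - y i) \<in> l2_set"
  using l2_set_add[of x "\<lambda>i. - y i"] by simp

lemma summable_cip:
  assumes "x \<in> l2_set" "y \<in> l2_set" shows "summable (\<lambda>i. x i * cnj (y i))"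
proof (rule summable_comparison_test')
  show "summable (\<lambda>i. (cmod (x i))\<^sup>2 + (cmod (y i))\<^sup>2)"
    using assms by (intro summable_add) (auto simp: l2_set_def)
  show "cmod (x i * cnj (y i)) \<le> (cmod (x i))\<^sup>2 + (cmod (y i))\<^sup>2" for i
    using sum_squares_bound[of "cmod (x i)" "cmod (y i)"]
      mult_nonneg_nonneg[OF norm_ge_zero norm_ge_zero, of "x i" "y i"]
    unfolding norm_mult complex_mod_cnj mult.assoc by linarith
qed

lemma Re_cip_self_l2:
  assumes "x \<in> l2_set" shows "Re (\<Sum>i. x i * cnj (x i)) = (\<Sum>i. (cmod (x i))\<^sup>2)"
proof -
  have "(\<lambda>i. complex_of_real ((cmod (x i))\<^sup>2)) sums complex_of_real (\<Sum>i. (cmod (x i))\<^sup>2)"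
    using assms by (intro sums_of_real summable_sums) (simp add: l2_set_def)
  then have "(\<Sum>i. complex_of_real ((cmod (x i))\<^sup>2)) = complex_of_real (\<Sum>i. (cmod (x i))\<^sup>2)"
    by (rule sums_unique[symmetric])
  then show ?thesis
    unfolding complex_norm_square[symmetric] by simp
qed

lemma abelian_group_l2: "abelian_group l2"
proof (rule abelian_groupI)
  fix x assume "x \<in> carrier l2"
  then show "\<exists>y\<in>carrier l2. y \<oplus>\<^bsub>l2\<^esub> x = \<zero>\<^bsub>l2\<^esub>"
    by (auto intro!: bexI[of _ "\<lambda>i. - x i"])
qed (auto simp: algebra_simps)

lemma ip_space_l2: "complex_inner_product_space l2"
proof -
  have m: "Module.module complex_field l2"
    by (rule moduleI[OF cring_complex_field abelian_group_l2]) (auto simp: algebra_simps)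
  have add: "cip l2 (x \<oplus>\<^bsub>l2\<^esub> y) z = cip l2 x z + cip l2 y z"
    if "x \<in> carrier l2" "y \<in> carrier l2" "z \<in> carrier l2" for x y z
    using that by (simp add: suminf_add summable_cip algebra_simps)
  have smult: "cip l2 (a \<odot>\<^bsub>l2\<^esub> x) y = a * cip l2 x y"
    if "x \<in> carrier l2" "y \<in> carrier l2" for a x y
    using that suminf_mult[OF summable_cip, of x y a] by (simp add: mult.assoc)
  have cnj: "cip l2 y x = cnj (cip l2 x y)" if "x \<in> carrier l2" "y \<in> carrier l2" for x y
  proof -
    have "(\<lambda>i. x i * cnj (y i)) sums cip l2 x y"
      using summable_cip that by (simp add: summable_sums)
    then have "(\<lambda>i. cnj (x i * cnj (y i))) sums cnj (cip l2 x y)"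
      by (simp only: sums_cnj)
    then show ?thesis
      by (simp add: sums_iff mult.commute)
  qed
  have pos: "0 < Re (cip l2 x x)" if x: "x \<in> carrier l2" "x \<noteq> \<zero>\<^bsub>l2\<^esub>" for x
  proof -
    obtain j where "x j \<noteq> 0"
      using x(2) by auto
    then have "0 < (\<Sum>i. (cmod (x i))\<^sup>2)"
      using x(1) by (intro suminf_pos2[of _ j]) (auto simp: l2_set_def)
    then show ?thesis
      using x(1) by (simp add: Re_cip_self_l2)
  qed
  show ?thesis
    by (intro complex_inner_product_space.intro[OF m] complex_inner_product_space_axioms.intro)
      (fact add smult cnj pos)+
qed

interpretation l2: complex_inner_product_space l2
  by (rule ip_space_l2)

lemma ip_norm_l2: "x \<in> l2_set \<Longrightarrow> ip_norm l2 x = sqrt (\<Sum>i. (cmod (x i))\<^sup>2)"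
  by (simp add: ip_norm_def Re_cip_self_l2)

lemma minus_l2: 
  assumes "x \<in> l2_set" "y \<in> l2_set" shows "x \<ominus>\<^bsub>l2\<^esub> y = (\<lambda>i. x i - y i)"
proof -
  have "\<ominus>\<^bsub>l2\<^esub> y = (\<lambda>i. - y i)"
    using assms by (intro l2.M.minus_equality) auto
  then show ?thesis
    by (simp add: a_minus_def)
qed

lemma ip_dist_l2:
  "\<lbrakk>x \<in> l2_set; y \<in> l2_set\<rbrakk> \<Longrightarrow> ip_dist l2 x y = sqrt (\<Sum>i. (cmod (x i - y i))\<^sup>2)"
  by (simp add: ip_dist_def minus_l2 ip_norm_l2)

lemma l2_set_diffD: "\<lbrakk>x \<in> l2_set; (\<lambda>i. x i - y i) \<in> l2_set\<rbrakk> \<Longrightarrow> y \<in> l2_set"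
  using l2_set_diff[of x "\<lambda>i. x i - y i"] by simp

lemma sum_le_ip_dist:
  assumes "x \<in> l2_set" "y \<in> l2_set" 
  shows "(\<Sum>i<k. (cmod (x i - y i))\<^sup>2) \<le> (ip_dist l2 x y)\<^sup>2"
proof -
  have "summable (\<lambda>i. (cmod (x i - y i))\<^sup>2)"
    using l2_set_diff[OF assms] by (simp add: l2_set_def)
  then show ?thesis
    using assms by (simp add: ip_dist_l2 sum_le_suminf suminf_nonneg)
qed

text \<open>The coordinatewise limit of a Cauchy sequence is a limit in norm, because the bounds on
  finite partial sums of the squared distances pass to the coordinatewise limit.\<close>

lemma complete_l2: "l2.ip.mcomplete"
  unfolding l2.ip.mcomplete_def
proof (intro allI impI)
  fix s assume s: "l2.ip.MCauchy s"
  have sl: "s n \<in> l2_set" for n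
    using s unfolding l2.ip.MCauchy_def by auto
  have cau: "\<exists>N. \<forall>m\<ge>N. \<forall>n\<ge>N. ip_dist l2 (s m) (s n) < e" if "e > 0" for e
    using s that unfolding l2.ip.MCauchy_def by metis
  have coord: "cmod (s m i - s n i) \<le> ip_dist l2 (s m) (s n)" for m n i
  proof -
    have "(cmod (s m i - s n i))\<^sup>2 \<le> (\<Sum>j<Suc i. (cmod (s m j - s n j))\<^sup>2)"
      by (rule member_le_sum) auto
    also have "\<dots> \<le> (ip_dist l2 (s m) (s n))\<^sup>2"
      by (rule sum_le_ip_dist[OF sl sl])
    finally show ?thesis
      by (rule power2_le_imp_le) simp
  qed
  have "Cauchy (\<lambda>n. s n i)" for i
    unfolding Cauchy_def dist_norm using cau coord by (meson order.strict_trans1)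
  then have "\<exists>l. (\<lambda>n. s n i) \<longlonglongrightarrow> l" for i
    by (simp add: Cauchy_convergent_iff convergent_def)
  then obtain x where x: "\<And>i. (\<lambda>n. s n i) \<longlonglongrightarrow> x i"
    by metis
  have close: "(\<lambda>i. s m i - x i) \<in> l2_set \<and> (\<Sum>i. (cmod (s m i - x i))\<^sup>2) \<le> e\<^sup>2"
    if N: "\<forall>m\<ge>N. \<forall>n\<ge>N. ip_dist l2 (s m) (s n) < e" and m: "m \<ge> N" for m N e
  proof -
    have part: "(\<Sum>i<k. (cmod (s m i - x i))\<^sup>2) \<le> e\<^sup>2" for k
    proof (rule LIMSEQ_le_const2)
      show "(\<lambda>n. \<Sum>i<k. (cmod (s m i - s n i))\<^sup>2) \<longlonglongrightarrow> (\<Sum>i<k. (cmod (s m i - x i))\<^sup>2)"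
        by (intro tendsto_intros x)
      have "(\<Sum>i<k. (cmod (s m i - s n i))\<^sup>2) \<le> e\<^sup>2" if n: "n \<ge> N" for n
      proof -
        have "(ip_dist l2 (s m) (s n))\<^sup>2 \<le> e\<^sup>2"
          using N m n by (intro power_mono) (auto intro: less_imp_le)
        then show ?thesis
          using sum_le_ip_dist[OF sl[of m] sl[of n]] by (rule order_trans[rotated])
      qed
      then show "\<exists>N. \<forall>n\<ge>N. (\<Sum>i<k. (cmod (s m i - s n i))\<^sup>2) \<le> e\<^sup>2"
        by blast
    qed
    have "summable (\<lambda>i. (cmod (s m i - x i))\<^sup>2)"
      by (rule bounded_imp_summable[where B = "e\<^sup>2"])
        (use part[of "Suc _"] in \<open>auto simp: lessThan_Suc_atMost\<close>)
    then show ?thesis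
      using part by (auto simp: l2_set_def intro: suminf_le_const)
  qed
  obtain N where "\<forall>m\<ge>N. \<forall>n\<ge>N. ip_dist l2 (s m) (s n) < 1"
    using cau[of 1] by auto
  then have "(\<lambda>i. s N i - x i) \<in> l2_set"
    using close by blast
  then have xl: "x \<in> l2_set"
    using l2_set_diffD[OF sl] by blast
  have "\<exists>N. \<forall>n\<ge>N. ip_dist l2 (s n) x < e" if e: "e > 0" for e
  proof -
    obtain N where N: "\<forall>m\<ge>N. \<forall>n\<ge>N. ip_dist l2 (s m) (s n) < e / 2"
      using cau[of "e / 2"] e by auto
    have "ip_dist l2 (s n) x < e" if "n \<ge> N" for n
    proof -
      have "ip_dist l2 (s n) x \<le> sqrt ((e / 2)\<^sup>2)"
        using close[OF N that] by (simp only: ip_dist_l2[OF sl xl] real_sqrt_le_iff)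
      also have "\<dots> < e"
        using e by simp
      finally show ?thesis .
    qed
    then show ?thesis by blast
  qed
  then have "limitin l2.ip.mtopology s x sequentially"
    unfolding l2.ip.limitin_metric eventually_sequentially using xl sl by simp
  then show "\<exists>x. limitin l2.ip.mtopology s x sequentially"
    by (intro exI)
qed

text \<open>The finitely supported sequences with entries in a countable dense set of complex
  numbers are dense.\<close>

lemma separable_l2: "separable_ip_space l2"
proof -
  obtain D :: "complex set" where D: "countable D"
      "\<And>X. \<lbrakk>open X; X \<noteq> {}\<rbrakk> \<Longrightarrow> \<exists>d\<in>D. d \<in> X"
    using countable_dense_exists by blast
  define pad :: "complex list \<Rightarrow> nat \<Rightarrow> complex"
    where "pad l i = (if i < length l then l ! i else 0)" for l i
  have pad: "pad l \<in> l2_set" for l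
    unfolding l2_set_def mem_Collect_eq
    by (rule summable_finite[of "{..<length l}"]) (auto simp: pad_def)
  have dense: "\<exists>y\<in>pad ` lists D. ip_dist l2 x y < r" if x: "x \<in> l2_set" and r: "r > 0" for x r
  proof -
    have "\<exists>k. \<forall>n\<ge>k. norm (\<Sum>i. (cmod (x (i + n)))\<^sup>2) < r\<^sup>2 / 2"
      using x r by (intro suminf_exist_split) (auto simp: l2_set_def)
    then obtain k where k: "norm (\<Sum>i. (cmod (x (i + k)))\<^sup>2) < r\<^sup>2 / 2"
      by blast
    \<comment> \<open>Errors below \<open>q\<close> in the first \<open>k\<close> entries contribute less than half of \<open>r\<^sup>2\<close>; the summand 1
      keeps the denominator nonzero for \<open>k = 0\<close>.\<close>
    define q where "q = r / sqrt (2 * (real k + 1))"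
    have q: "q > 0" "q\<^sup>2 = r\<^sup>2 / (2 * (real k + 1))"
      using r by (simp_all add: q_def power_divide)
    have "\<exists>d\<in>D. d \<in> ball (x i) q" for i
      using q by (intro D(2)) auto
    then obtain d where d: "\<And>i. d i \<in> D" "\<And>i. cmod (x i - d i) < q"
      unfolding mem_ball dist_norm by metis
    define l where "l = map d [0..<k]"
    have sm: "summable (\<lambda>i. (cmod (x i - pad l i))\<^sup>2)"
      using l2_set_diff[OF x pad, of l] by (simp add: l2_set_def)
    have "(\<Sum>i. (cmod (x i - pad l i))\<^sup>2)
        = (\<Sum>i. (cmod (x (i + k) - pad l (i + k)))\<^sup>2) + (\<Sum>i<k. (cmod (x i - pad l i))\<^sup>2)"
      by (rule suminf_split_initial_segment[OF sm])
    also have "(\<Sum>i. (cmod (x (i + k) - pad l (i + k)))\<^sup>2) = (\<Sum>i. (cmod (x (i + k)))\<^sup>2)"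
      by (simp add: pad_def l_def)
    also have "(\<Sum>i<k. (cmod (x i - pad l i))\<^sup>2) \<le> (\<Sum>i<k. q\<^sup>2)"
      by (intro sum_mono power_mono) (auto simp: pad_def l_def intro: less_imp_le[OF d(2)])
    also have "\<dots> \<le> r\<^sup>2 / 2"
      using r by (simp add: q(2) field_simps)
    also have "(\<Sum>i. (cmod (x (i + k)))\<^sup>2) < r\<^sup>2 / 2"
      using k by simp
    finally have "(\<Sum>i. (cmod (x i - pad l i))\<^sup>2) < r\<^sup>2"
      by simp
    then have "ip_dist l2 x (pad l) < r"
      using r real_sqrt_less_mono by (fastforce simp: ip_dist_l2[OF x pad])
    moreover have "l \<in> lists D"
      using d by (auto simp: l_def)
    ultimately show ?thesis by blast
  qed
  show ?thesis
    unfolding l2.separable_iff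
    by (rule exI[of _ "pad ` lists D"]) (use D(1) pad dense in auto)
qed

lemma hilbert_space_l2: "complex_hilbert_space l2"
  by (intro complex_hilbert_space.intro ip_space_l2 complex_hilbert_space_axioms.intro complete_l2)

lemma finsum_l2:
  "\<lbrakk>finite A; \<And>k. k \<in> A \<Longrightarrow> f k \<in> l2_set\<rbrakk> \<Longrightarrow> finsum l2 f A = (\<lambda>i. \<Sum>k\<in>A. f k i)"
  by (induction A rule: finite_induct) (auto simp: l2.M.finsum_insert Pi_def)

section \<open>Splitting a sequence into its even and odd parts\<close>

text \<open>In the notation of the introduction, \<open>evens\<close> and \<open>odds\<close> are \<open>S*\<close> and \<open>R*\<close>, and
  \<open>interleave u v\<close> is \<open>S u + R v\<close>.\<close>

definition evens :: "(nat \<Rightarrow> 'a) \<Rightarrow> nat \<Rightarrow> 'a" where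
  "evens x i = x (2 * i)"

definition odds :: "(nat \<Rightarrow> 'a) \<Rightarrow> nat \<Rightarrow> 'a" where
  "odds x i = x (Suc (2 * i))"

definition interleave :: "(nat \<Rightarrow> 'a) \<Rightarrow> (nat \<Rightarrow> 'a) \<Rightarrow> nat \<Rightarrow> 'a" where
  "interleave u v i = (if even i then u (i div 2) else v (i div 2))"

lemma interleave_nth [simp]:
  "interleave u v (2 * i) = u i" "interleave u v (Suc (2 * i)) = v i"
  by (simp_all add: interleave_def)

lemma evens_interleave [simp]: "evens (interleave u v) = u"
  and odds_interleave [simp]: "odds (interleave u v) = v"
  by (simp_all add: evens_def odds_def fun_eq_iff)

lemma interleave_evens_odds [simp]: "interleave (evens x) (odds x) = x"
  by (auto simp: interleave_def evens_def odds_def fun_eq_iff)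

lemma
  assumes "u \<in> l2_set" "v \<in> l2_set"
  shows l2_set_interleave [simp]: "interleave u v \<in> l2_set"
    and norm_interleave: "(ip_norm l2 (interleave u v))\<^sup>2 = (ip_norm l2 u)\<^sup>2 + (ip_norm l2 v)\<^sup>2"
proof -
  have "(\<lambda>i. if even i then (cmod (u (i div 2)))\<^sup>2 else (cmod (v ((i - 1) div 2)))\<^sup>2) sums
      ((\<Sum>i. (cmod (v i))\<^sup>2) + (\<Sum>i. (cmod (u i))\<^sup>2))"
    using assms by (intro sums_if summable_sums) (auto simp: l2_set_def)
  moreover have "(cmod (interleave u v i))\<^sup>2 =
      (if even i then (cmod (u (i div 2)))\<^sup>2 else (cmod (v ((i - 1) div 2)))\<^sup>2)" for i
    by (auto simp: interleave_def elim: oddE)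
  ultimately have s: "(\<lambda>i. (cmod (interleave u v i))\<^sup>2) sums
      ((\<Sum>i. (cmod (v i))\<^sup>2) + (\<Sum>i. (cmod (u i))\<^sup>2))"
    by simp
  show "interleave u v \<in> l2_set"
    using s by (simp add: l2_set_def sums_iff)
  then show "(ip_norm l2 (interleave u v))\<^sup>2 = (ip_norm l2 u)\<^sup>2 + (ip_norm l2 v)\<^sup>2"
    using s assms by (simp add: ip_norm_l2 sums_iff suminf_nonneg l2_set_def)
qed

lemma l2_set_evens [simp]: "x \<in> l2_set \<Longrightarrow> evens x \<in> l2_set"
  using summable_reindex[of "\<lambda>i. (cmod (x i))\<^sup>2" "\<lambda>i. 2 * i"]
  by (simp add: l2_set_def evens_def o_def inj_on_def)

lemma l2_set_odds [simp]: "x \<in> l2_set \<Longrightarrow> odds x \<in> l2_set"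
  using summable_reindex[of "\<lambda>i. (cmod (x i))\<^sup>2" "\<lambda>i. Suc (2 * i)"]
  by (simp add: l2_set_def odds_def o_def inj_on_def)

lemma norm_evens_odds:
  "x \<in> l2_set \<Longrightarrow> (ip_norm l2 x)\<^sup>2 = (ip_norm l2 (evens x))\<^sup>2 + (ip_norm l2 (odds x))\<^sup>2"
  using norm_interleave[of "evens x" "odds x"] by simp

section \<open>Bounded operators\<close>

lemma norm_scale_l2:
  assumes "x \<in> l2_set" shows "ip_norm l2 (\<lambda>i. a * x i) = cmod a * ip_norm l2 x"
proof -
  have "(\<Sum>i. (cmod a)\<^sup>2 * (cmod (x i))\<^sup>2) = (cmod a)\<^sup>2 * (\<Sum>i. (cmod (x i))\<^sup>2)"
    using assms by (intro suminf_mult) (simp add: l2_set_def)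
  then show ?thesis
    using assms by (simp add: ip_norm_l2 norm_mult power_mult_distrib real_sqrt_mult)
qed

text \<open>A nonnegative bound is what products of bounds require.\<close>

lemma bounded_operator_l2_iff:
  "bounded_operator l2 T \<longleftrightarrow>
     (\<forall>x\<in>l2_set. T x \<in> l2_set) \<and>
     (\<forall>x\<in>l2_set. \<forall>y\<in>l2_set. T (\<lambda>i. x i + y i) = (\<lambda>i. T x i + T y i)) \<and>
     (\<forall>a. \<forall>x\<in>l2_set. T (\<lambda>i. a * x i) = (\<lambda>i. a * T x i)) \<and>
     (\<exists>B\<ge>0. \<forall>x\<in>l2_set. ip_norm l2 (T x) \<le> B * ip_norm l2 x)"
proof -
  have "(\<exists>B. \<forall>x\<in>l2_set. ip_norm l2 (T x) \<le> B * ip_norm l2 x) \<longleftrightarrow>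
      (\<exists>B\<ge>0. \<forall>x\<in>l2_set. ip_norm l2 (T x) \<le> B * ip_norm l2 x)" (is "?L \<longleftrightarrow> ?R")
  proof
    assume ?L
    then obtain B where B: "\<forall>x\<in>l2_set. ip_norm l2 (T x) \<le> B * ip_norm l2 x" ..
    have "ip_norm l2 (T x) \<le> \<bar>B\<bar> * ip_norm l2 x" if "x \<in> l2_set" for x
    proof -
      have "B * ip_norm l2 x \<le> \<bar>B\<bar> * ip_norm l2 x"
        using l2.ip_norm_nonneg[of x] that by (intro mult_right_mono) auto
      then show ?thesis
        using B that by force
    qed
    then show ?R
      by (intro exI[of _ "\<bar>B\<bar>"]) simp
  qed blast
  then show ?thesis
    by (simp add: bounded_operator_def Pi_iff)
qed

lemma bounded_id: "bounded_operator l2 (\<lambda>x. x)"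
  unfolding bounded_operator_l2_iff by (auto intro!: exI[of _ 1])

lemma bounded_zero: "bounded_operator l2 (\<lambda>x i. 0)"
  unfolding bounded_operator_l2_iff by (auto intro!: exI[of _ 0] simp: ip_norm_l2)

lemma bounded_add:
  assumes "bounded_operator l2 T" "bounded_operator l2 U"
  shows "bounded_operator l2 (\<lambda>x i. T x i + U x i)"
proof -
  obtain B where B: "B \<ge> 0" "\<forall>x\<in>l2_set. ip_norm l2 (T x) \<le> B * ip_norm l2 x"
    using assms(1) unfolding bounded_operator_l2_iff by blast
  obtain C where C: "C \<ge> 0" "\<forall>x\<in>l2_set. ip_norm l2 (U x) \<le> C * ip_norm l2 x"
    using assms(2) unfolding bounded_operator_l2_iff by blast
  have TU: "T x \<in> l2_set" "U x \<in> l2_set" if "x \<in> l2_set" for x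
    using assms that unfolding bounded_operator_l2_iff by auto
  have "ip_norm l2 (\<lambda>i. T x i + U x i) \<le> (B + C) * ip_norm l2 x" if x: "x \<in> l2_set" for x
    using l2.ip_norm_triangle[of "T x" "U x"] B(2) C(2) TU x by (force simp: distrib_right)
  then have "\<exists>B\<ge>0. \<forall>x\<in>l2_set. ip_norm l2 (\<lambda>i. T x i + U x i) \<le> B * ip_norm l2 x"
    using B(1) C(1) by (intro exI[of _ "B + C"]) auto
  then show ?thesis
    using assms unfolding bounded_operator_l2_iff by (auto simp: algebra_simps)
qed

lemma bounded_compose:
  assumes "bounded_operator l2 T" "bounded_operator l2 U"
  shows "bounded_operator l2 (\<lambda>x. T (U x))"
proof -
  obtain B C where B: "B \<ge> 0" "\<forall>x\<in>l2_set. ip_norm l2 (T x) \<le> B * ip_norm l2 x"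
    and C: "C \<ge> 0" "\<forall>x\<in>l2_set. ip_norm l2 (U x) \<le> C * ip_norm l2 x"
    and U: "\<And>x. x \<in> l2_set \<Longrightarrow> U x \<in> l2_set"
    using assms unfolding bounded_operator_l2_iff by blast
  have "ip_norm l2 (T (U x)) \<le> (B * C) * ip_norm l2 x" if x: "x \<in> l2_set" for x
  proof -
    have "ip_norm l2 (T (U x)) \<le> B * ip_norm l2 (U x)"
      using B(2) U[OF x] by blast
    also have "\<dots> \<le> B * (C * ip_norm l2 x)"
      using B(1) C(2) x by (intro mult_left_mono) auto
    finally show ?thesis by simp
  qed
  then have "\<exists>B\<ge>0. \<forall>x\<in>l2_set. ip_norm l2 (T (U x)) \<le> B * ip_norm l2 x"
    using B(1) C(1) by (intro exI[of _ "B * C"]) auto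
  then show ?thesis
    using assms unfolding bounded_operator_l2_iff by auto
qed

lemma bounded_scale:
  assumes "bounded_operator l2 T" shows "bounded_operator l2 (\<lambda>x i. a * T x i)"
proof -
  have "bounded_operator l2 (\<lambda>x i. a * x i)"
    unfolding bounded_operator_l2_iff
    by (auto intro!: exI[of _ "cmod a"] simp: norm_scale_l2 algebra_simps)
  then show ?thesis
    using assms by (rule bounded_compose)
qed

lemma bounded_diff:
  assumes "bounded_operator l2 T" "bounded_operator l2 U"
  shows "bounded_operator l2 (\<lambda>x i. T x i - U x i)"
  using bounded_add[OF assms(1) bounded_scale[OF assms(2), of "-1"]] by simp

lemma bounded_evens:
  assumes "bounded_operator l2 T" shows "bounded_operator l2 (\<lambda>x. evens (T x))"
proof -
  have "ip_norm l2 (evens x) \<le> 1 * ip_norm l2 x" if "x \<in> l2_set" for x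
    by (rule power2_le_imp_le) (simp_all add: that norm_evens_odds[OF that] l2.ip_norm_nonneg)
  then have "bounded_operator l2 evens"
    unfolding bounded_operator_l2_iff by (auto intro!: exI[of _ 1]) (auto simp: evens_def)
  then show ?thesis
    using assms by (rule bounded_compose)
qed

lemma bounded_odds:
  assumes "bounded_operator l2 T" shows "bounded_operator l2 (\<lambda>x. odds (T x))"
proof -
  have "ip_norm l2 (odds x) \<le> 1 * ip_norm l2 x" if "x \<in> l2_set" for x
    by (rule power2_le_imp_le) (simp_all add: that norm_evens_odds[OF that] l2.ip_norm_nonneg)
  then have "bounded_operator l2 odds"
    unfolding bounded_operator_l2_iff by (auto intro!: exI[of _ 1]) (auto simp: odds_def)
  then show ?thesis
    using assms by (rule bounded_compose)
qed

lemma bounded_interleave: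
  assumes "bounded_operator l2 T" "bounded_operator l2 U"
  shows "bounded_operator l2 (\<lambda>x. interleave (T x) (U x))"
proof -
  have 0: "ip_norm l2 (\<lambda>i. 0) = 0"
    by (simp add: ip_norm_l2)
  have "ip_norm l2 (interleave x (\<lambda>i. 0)) \<le> 1 * ip_norm l2 x"
    and "ip_norm l2 (interleave (\<lambda>i. 0) x) \<le> 1 * ip_norm l2 x" if "x \<in> l2_set" for x
    by (rule power2_le_imp_le; simp add: that norm_interleave 0 l2.ip_norm_nonneg)+
  then have "bounded_operator l2 (\<lambda>x. interleave x (\<lambda>i. 0))"
    and "bounded_operator l2 (\<lambda>x. interleave (\<lambda>i. 0) x)"
    unfolding bounded_operator_l2_iff
    by (auto intro!: exI[of _ 1]) (auto simp: interleave_def)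
  note LR = this[THEN bounded_compose]
  have "(\<lambda>x i. interleave (T x) (\<lambda>i. 0) i + interleave (\<lambda>i. 0) (U x) i)
      = (\<lambda>x. interleave (T x) (U x))"
    by (auto simp: interleave_def fun_eq_iff)
  then show ?thesis
    using bounded_add[OF LR(1)[OF assms(1)] LR(2)[OF assms(2)]] by simp
qed

lemmas bounded_intros =
  bounded_id bounded_zero bounded_add bounded_diff bounded_scale
  bounded_evens bounded_odds bounded_interleave

section \<open>Five idempotents with scalar sum\<close>

text \<open>With respect to the even and odd parts, \<open>tilt e A\<close> is the column \<open>(A, e (1 - A))\<close> times the row
  \<open>(1, e)\<close>.\<close>

definition tilt :: "complex \<Rightarrow> ((nat \<Rightarrow> complex) \<Rightarrow> nat \<Rightarrow> complex) \<Rightarrow> (nat \<Rightarrow> complex) \<Rightarrow> nat \<Rightarrow> complex"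
  where "tilt e A x = (let w = (\<lambda>i. evens x i + e * odds x i) in
     interleave (A w) (\<lambda>i. e * (w i - A w i)))"

text \<open>The row times the column is \<open>A + (1 - A) = 1\<close>.\<close>

lemma tilt_idem:
  assumes "e * e = 1" shows "tilt e A (tilt e A x) = tilt e A x"
  using assms by (simp add: tilt_def Let_def mult.assoc[symmetric])

lemma bounded_tilt:
  assumes "bounded_operator l2 A" shows "bounded_operator l2 (tilt e A)"
  unfolding tilt_def Let_def
  by (intro bounded_intros bounded_compose[OF assms])

text \<open>The blocks off the diagonal are odd in \<open>e\<close> and cancel.\<close>

lemma tilt_sum:
  assumes A: "bounded_operator l2 A" and x: "x \<in> l2_set"
  shows "tilt 1 A x i + tilt (-1) A x i =
    interleave (\<lambda>i. 2 * A (evens x) i) (\<lambda>i. 2 * (odds x i - A (odds x) i)) i"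
proof -
  have add: "A (\<lambda>i. u i + v i) = (\<lambda>i. A u i + A v i)" and scale: "A (\<lambda>i. a * u i) = (\<lambda>i. a * A u i)"
    if "u \<in> l2_set" "v \<in> l2_set" for u v a
    using A that unfolding bounded_operator_l2_iff by auto
  have "A (\<lambda>i. evens x i + e * odds x i) = (\<lambda>i. A (evens x) i + e * A (odds x) i)" for e
    using x by (simp add: add scale)
  from this[of 1] this[of "-1"] show ?thesis
    by (auto simp: tilt_def Let_def interleave_def)
qed

text \<open>In the same notation, \<open>shear e k\<close> is the column \<open>(1, - e k S)\<close> times the row
  \<open>((2 + k) / 2, e S* / 2)\<close>.\<close>

definition shear :: "complex \<Rightarrow> complex \<Rightarrow> (nat \<Rightarrow> complex) \<Rightarrow> nat \<Rightarrow> complex"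
  where "shear e k x = (let w = (\<lambda>i. 1/2 * ((2 + k) * evens x i + e * evens (odds x) i)) in
     interleave w (interleave (\<lambda>i. - (e * k) * w i) (\<lambda>i. 0)))"

text \<open>The row times the column is \<open>(2 + k) / 2 - k / 2 = 1\<close>, because \<open>S* S = 1\<close>.\<close>

lemma shear_idem:
  assumes "e * e = 1" shows "shear e k (shear e k x) = shear e k x"
proof -
  have "1/2 * ((2 + k) * z + e * (- (e * k) * z)) = z" for z
  proof -
    have "e * (- (e * k) * z) = - ((e * e) * (k * z))"
      by (simp add: ac_simps)
    then show ?thesis
      using assms by (simp add: distrib_right)
  qed
  then show ?thesis
    by (simp only: shear_def Let_def evens_interleave odds_interleave)
qed

lemma bounded_shear: "bounded_operator l2 (shear e k)"
  unfolding shear_def Let_def by (intro bounded_intros)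

lemma shear_sum:
  "shear 1 k x i + shear (-1) k x i =
    interleave (\<lambda>i. (2 + k) * evens x i)
      (interleave (\<lambda>i. - k * evens (odds x) i) (\<lambda>i. 0)) i"
  by (simp add: shear_def Let_def interleave_def field_simps)

text \<open>The even entries give the first block of the sum, where \<open>E\<close> cancels against \<open>2 A\<close>.  In the odd
  entries \<open>E\<close> and \<open>F\<close> combine to the diagonal operator \<open>E + F\<close>, whose two values are evened out by the
  last pair.\<close>

lemma five_idempotents:
  fixes c :: complex
  defines "m \<equiv> c - 2"
  defines "E \<equiv> tilt 1 (\<lambda>w i. m * w i)" and "F \<equiv> tilt (-1) (\<lambda>w i. m * w i)"
  defines "A \<equiv> \<lambda>w i. 1/2 * ((2 - 3 * m) * w i - E w i)"
  assumes x: "x \<in> l2_set"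
  shows "interleave (E (evens x)) (F (odds x)) i + (tilt 1 A x i + tilt (-1) A x i)
    + (shear 1 (4 * m - 2) x i + shear (-1) (4 * m - 2) x i) = c * x i"
proof -
  have bm: "bounded_operator l2 (\<lambda>w i. m * w i)"
    by (intro bounded_intros)
  have bA: "bounded_operator l2 A"
    unfolding A_def E_def by (intro bounded_intros bounded_tilt bm)
  have EF: "E v j + F v j = interleave (\<lambda>i. 2 * m * evens v i) (\<lambda>i. (2 - 2 * m) * odds v i) j"
    if "v \<in> l2_set" for v j
    unfolding E_def F_def tilt_sum[OF bm that] by (simp add: algebra_simps)
  let ?L = "\<lambda>i. interleave (E (evens x)) (F (odds x)) i + (tilt 1 A x i + tilt (-1) A x i)
    + (shear 1 (4 * m - 2) x i + shear (-1) (4 * m - 2) x i)"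
  have c: "c = 2 + m" by (simp add: m_def)
  have "?L (2 * j) = c * x (2 * j)" for j
    unfolding tilt_sum[OF bA x] shear_sum interleave_nth
    by (simp add: A_def evens_def c algebra_simps)
  moreover have "?L (Suc (2 * j)) = c * x (Suc (2 * j))" for j
  proof -
    have "?L (Suc (2 * j)) = (E (odds x) j + F (odds x) j) + 3 * m * odds x j
        + interleave (\<lambda>i. - (4 * m - 2) * evens (odds x) i) (\<lambda>i. 0) j"
      unfolding tilt_sum[OF bA x] shear_sum interleave_nth
      by (simp add: A_def algebra_simps)
    \<comment> \<open>The parity of \<open>j\<close> decides between the ranges of \<open>S\<close> and \<open>R\<close>: the scalar is
      \<open>2 m + 3 m - (4 m - 2)\<close> on the first and \<open>(2 - 2 m) + 3 m\<close> on the second.\<close>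
    also have "\<dots> = c * odds x j"
      using x by (cases "even j") (auto simp: EF interleave_def evens_def odds_def c algebra_simps
        elim!: evenE oddE)
    finally show ?thesis by (simp add: odds_def)
  qed
  ultimately show ?thesis
    by (cases "even i") (auto elim!: evenE oddE)
qed

theorem proposition12:
  fixes n :: nat
  assumes "n \<ge> 5"
  shows "Lambda_bd n = UNIV"
proof -
  have "c \<in> Lambda_bd n" for c
  proof -
    define m where "m = c - 2"
    define E where "E = tilt 1 (\<lambda>w i. m * w i)"
    define F where "F = tilt (-1) (\<lambda>w i. m * w i)"
    define A where "A = (\<lambda>w i. 1/2 * ((2 - 3 * m) * w i - E w i))"
    define Q :: "nat \<Rightarrow> (nat \<Rightarrow> complex) \<Rightarrow> nat \<Rightarrow> complex" where
      "Q k = (if k = 1 then (\<lambda>x. interleave (E (evens x)) (F (odds x)))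
        else if k = 2 then tilt 1 A else if k = 3 then tilt (-1) A
        else if k = 4 then shear 1 (4 * m - 2) else if k = 5 then shear (-1) (4 * m - 2)
        else (\<lambda>x i. 0))" for k
    have bm: "bounded_operator l2 (\<lambda>w i. m * w i)"
      by (intro bounded_intros)
    have bE: "bounded_operator l2 E" and bF: "bounded_operator l2 F"
      unfolding E_def F_def by (intro bounded_tilt bm)+
    have bA: "bounded_operator l2 A"
      unfolding A_def by (intro bounded_intros bE)
    have idem: "Q k (Q k x) = Q k x" for k x
      by (auto simp: Q_def E_def F_def tilt_idem shear_idem)
    have bQ: "bounded_operator l2 (Q k)" for k
      by (auto simp: Q_def intro!: bounded_tilt bA bounded_shear bounded_interleave bounded_zero
          bounded_compose[OF bE] bounded_compose[OF bF] bounded_evens bounded_odds bounded_id)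
    have sum: "finsum l2 (\<lambda>k. Q k x) {1..n} = c \<odot>\<^bsub>l2\<^esub> x" if x: "x \<in> l2_set" for x
    proof -
      have "finsum l2 (\<lambda>k. Q k x) {1..n} = (\<lambda>i. \<Sum>k\<in>{1..n}. Q k x i)"
        using bQ x by (intro finsum_l2) (auto simp: bounded_operator_l2_iff)
      also have "\<dots> = (\<lambda>i. \<Sum>k\<in>{1..5}. Q k x i)"
        using assms by (intro ext sum.mono_neutral_right) (auto simp: Q_def)
      also have "{1..5::nat} = {1, 2, 3, 4, 5}"
        by auto
      also have "(\<lambda>i. \<Sum>k\<in>{1, 2, 3, 4, 5}. Q k x i) = (\<lambda>i. c * x i)"
        using five_idempotents[OF x, of c, folded m_def, folded E_def F_def, folded A_def]
        by (simp add: Q_def add.assoc)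
      finally show ?thesis by simp
    qed
    have "(\<lambda>i. if i = 0 then 1 else 0) \<in> carrier l2"
      by (auto simp: l2_set_def intro!: summable_finite[of "{0}"] split: if_splits)
    moreover have "(\<lambda>i. if i = 0 then 1 else 0) \<noteq> \<zero>\<^bsub>l2\<^esub>"
      by (auto simp: fun_eq_iff)
    ultimately have "carrier l2 \<noteq> {\<zero>\<^bsub>l2\<^esub>}"
      by blast
    moreover have "scalar_sum_of_idempotents l2 n Q c"
      unfolding scalar_sum_of_idempotents_def l2_simps(1) using bQ idem sum by blast
    ultimately show ?thesis
      by (rule Lambda_bd_I[OF hilbert_space_l2 separable_l2])
  qed
  then show ?thesis by blast
qed

end
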